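(* Let $\alpha$ be a non-negative increasing sequence tending to infinity, let $K(b_{n,k})$ be a Köthe space, and let $\theta=(\theta_n)_{n\in\mathbb{N}_0}\in(\Lambda_1(\alpha))'$. Assume that for every $m\in\mathbb{N}$ the sequence $(e^{-\frac1m\alpha_n})_{n\in\mathbb{N}}$ belongs to $K(b_{n,k})$. Then the Hankel operator $H_\theta:\Lambda_1(\alpha)\to K(b_{n,k})$ is well-defined and continuous. If, moreover, $K(b_{n,k})$ is Montel, then $H_\theta$ is compact.
   Context: $\mathbb{N}=\{1,2,\dots\}$, $\mathbb{N}_0=\mathbb{N}\cup\{0\}$. A Köthe matrix is a matrix $(b_{n,k})_{n,k\in\mathbb{N}}$ of non-negative numbers such that for each $n$ there is $k$ with $b_{n,k}>0$, and $b_{n,k}\le b_{n,k+1}$ for all $n,k$. The associated Köthe space is the Fréchet space $K(b_{n,k})=\{x=(x_n)_{n\in\mathbb{N}}:\ \|x\|_k:=\sum_{n=1}^\infty|x_n|b_{n,k}<\infty\ \text{for all }k\in\mathbb{N}\}$ with seminorms $\|\cdot\|_k$, $k\in\mathbb{N}$. For a non-negative increasing sequence $\alpha=(\alpha_n)_{n\in\mathbb{N}}$ with $\alpha_n\to\infty$, the power series space of finite type is $\Lambda_1(\alpha)=K(e^{-\frac1k\alpha_n})$, i.e. $\|x\|_k=\sum_{n=1}^\infty|x_n|e^{-\frac1k\alpha_n}$. Its dual is identified with the sequence space $(\Lambda_1(\alpha))'=\{y=(y_n)_{n\in\mathbb{N}}:\ \sup_n|y_n|e^{\frac1k\alpha_n}<\infty\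 \text{for some }k\in\mathbb{N}\}$. A Fréchet space is Montel if each of its bounded sets is relatively compact. The sequence $e_n$ has $1$ in the $n$-th place and $0$ elsewhere. A sequence $\theta=(\theta_n)_{n\in\mathbb{N}_0}$ is identified with the sequence $(\theta_{n-1})_{n\in\mathbb{N}}=(\theta_0,\theta_1,\theta_2,\dots)$ when it is said to belong to a sequence space. The Hankel operator $H_\theta$ from a Köthe space $E$ to a Köthe space $F$ is given by $H_\theta e_n=(\theta_{n-1},\theta_n,\theta_{n+1},\dots)=\sum_{j=1}^\infty\theta_{j+n-2}e_j$ for $n\in\mathbb{N}$ and $H_\theta x=\sum_{n=1}^\infty x_nH_\theta e_n$ for $x=(x_n)\in E$. It is well-defined if $H_\theta e_n\in F$ for all $n$ and the series $\sum_n x_nH_\theta e_n$ converges in $F$ for every $x\in E$. A linear map $T:E\to F$ between Fréchet spaces is compact if $T(U)$ is precompact in $F$ for some neighborhood $U$ of zero in $E$. *)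

theory Defs
  imports "HOL-Analysis.Analysis"
begin

text \<open>
  Scalars are an arbitrary complete \<open>'a :: real_normed_field\<close>, which covers both real and
  complex sequence spaces.  All indices are shifted to start at 0: the library index \<open>i\<close>
  stands for \<open>n = i + 1\<close>, both for places of a sequence and for the number \<open>k\<close> of a
  seminorm.  Under this shift a sequence \<open>(\<theta>\<^sub>n)\<close> with \<open>n \<ge> 0\<close>, regarded as the element
  \<open>(\<theta>\<^sub>0, \<theta>\<^sub>1, \<dots>)\<close> of a sequence space, is the function \<open>\<theta>\<close> itself.
\<close>

definition kothe_matrix :: "(nat \<Rightarrow> nat \<Rightarrow> real) \<Rightarrow> bool" where
  "kothe_matrix b \<longleftrightarrow>
     (\<forall>n k. 0 \<le> b n k) \<and> (\<forall>n. \<exists>k. 0 < b n k) \<and> (\<forall>n k. b n k \<le> b n (Suc k))"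

definition kothe_space :: "(nat \<Rightarrow> nat \<Rightarrow> real) \<Rightarrow> (nat \<Rightarrow> 'a::real_normed_field) set" where
  "kothe_space b = {x. \<forall>k. summable (\<lambda>n. norm (x n) * b n k)}"

definition kothe_seminorm ::
    "(nat \<Rightarrow> nat \<Rightarrow> real) \<Rightarrow> nat \<Rightarrow> (nat \<Rightarrow> 'a::real_normed_field) \<Rightarrow> real" where
  "kothe_seminorm b k x = (\<Sum>n. norm (x n) * b n k)"

definition kothe_ball ::
    "(nat \<Rightarrow> nat \<Rightarrow> real) \<Rightarrow> nat \<Rightarrow> (nat \<Rightarrow> 'a::real_normed_field) \<Rightarrow> real \<Rightarrow> (nat \<Rightarrow> 'a) set" where
  "kothe_ball b k x r = {y \<in> kothe_space b. kothe_seminorm b k (\<lambda>n. y n - x n) < r}"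

definition kothe_topology ::
    "(nat \<Rightarrow> nat \<Rightarrow> real) \<Rightarrow> (nat \<Rightarrow> 'a::real_normed_field) topology" where
  "kothe_topology b =
     topology_generated_by {kothe_ball b k x r | k x r. x \<in> kothe_space b \<and> 0 < r}"

lemma topspace_kothe_topology: "topspace (kothe_topology b) = kothe_space b"
proof -
  have "x \<in> kothe_ball b 0 x 1" if "x \<in> kothe_space b" for x :: "nat \<Rightarrow> 'a"
    using that by (simp add: kothe_ball_def kothe_seminorm_def)
  then have "x \<in> \<Union>{kothe_ball b k x r | k x r. x \<in> kothe_space b \<and> 0 < r}"
    if "x \<in> kothe_space b" for x :: "nat \<Rightarrow> 'a"
    using that zero_less_one by blast
  then show ?thesis
    by (auto simp: kothe_topology_def kothe_ball_def)
qed

text \<open>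
  The next four notions are meant for topologies that turn a linear subspace of the space of
  all sequences (the \<open>topspace\<close>) into a topological vector space, with pointwise operations.
  Boundedness is in the sense of von Neumann, and precompactness is total boundedness with
  respect to the translation-invariant uniformity.
\<close>

definition seq_bounded :: "(nat \<Rightarrow> 'a::real_normed_field) topology \<Rightarrow> (nat \<Rightarrow> 'a) set \<Rightarrow> bool" where
  "seq_bounded X B \<longleftrightarrow> B \<subseteq> topspace X \<and>
     (\<forall>U. openin X U \<and> (\<lambda>n. 0) \<in> U \<longrightarrow> (\<exists>t::real>0. B \<subseteq> (\<lambda>u n. of_real t * u n) ` U))"

definition montel :: "(nat \<Rightarrow> 'a::real_normed_field) topology \<Rightarrow> bool" where
  "montel X \<longleftrightarrow> (\<forall>B. seq_bounded X B \<longrightarrow> compactin X (X closure_of B))"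

definition precompact :: "(nat \<Rightarrow> 'a::real_normed_field) topology \<Rightarrow> (nat \<Rightarrow> 'a) set \<Rightarrow> bool" where
  "precompact X S \<longleftrightarrow> S \<subseteq> topspace X \<and>
     (\<forall>U. openin X U \<and> (\<lambda>n. 0) \<in> U \<longrightarrow>
        (\<exists>F. finite F \<and> F \<subseteq> topspace X \<and> S \<subseteq> (\<Union>f\<in>F. (\<lambda>u n. f n + u n) ` U)))"

definition compact_operator ::
    "(nat \<Rightarrow> 'a::real_normed_field) topology \<Rightarrow> (nat \<Rightarrow> 'a) topology
      \<Rightarrow> ((nat \<Rightarrow> 'a) \<Rightarrow> (nat \<Rightarrow> 'a)) \<Rightarrow> bool" where
  "compact_operator X Y T \<longleftrightarrow>
     T ` topspace X \<subseteq> topspace Y \<and>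
     (\<forall>x\<in>topspace X. \<forall>y\<in>topspace X. T (\<lambda>n. x n + y n) = (\<lambda>n. T x n + T y n)) \<and>
     (\<forall>c. \<forall>x\<in>topspace X. T (\<lambda>n. c * x n) = (\<lambda>n. c * T x n)) \<and>
     (\<exists>U. openin X U \<and> (\<lambda>n. 0) \<in> U \<and> precompact Y (T ` U))"

text \<open>
  The power series space of finite type \<open>\<Lambda>\<^sub>1(\<alpha>)\<close> is the Koethe space of the following matrix.
\<close>

definition power_series_matrix :: "(nat \<Rightarrow> real) \<Rightarrow> nat \<Rightarrow> nat \<Rightarrow> real" where
  "power_series_matrix \<alpha> n k = exp (- (1 / real (Suc k)) * \<alpha> n)"

definition power_series_dual :: "(nat \<Rightarrow> real) \<Rightarrow> (nat \<Rightarrow> 'a::real_normed_field) set" where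
  "power_series_dual \<alpha> =
     {y. \<exists>k. bdd_above (range (\<lambda>n. norm (y n) * exp (1 / real (Suc k) * \<alpha> n)))}"

definition hankel_column :: "(nat \<Rightarrow> 'a::real_normed_field) \<Rightarrow> nat \<Rightarrow> (nat \<Rightarrow> 'a)" where
  "hankel_column \<theta> n = (\<lambda>j. \<theta> (j + n))"

definition hankel_sums ::
    "(nat \<Rightarrow> nat \<Rightarrow> real) \<Rightarrow> (nat \<Rightarrow> 'a::real_normed_field) \<Rightarrow> (nat \<Rightarrow> 'a) \<Rightarrow> (nat \<Rightarrow> 'a) \<Rightarrow> bool" where
  "hankel_sums b \<theta> x y \<longleftrightarrow>
     limitin (kothe_topology b) (\<lambda>N j. \<Sum>n<N. x n * hankel_column \<theta> n j) y sequentially"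

text \<open>
  The sum is unique for a Koethe matrix \<open>b\<close>, since the topology is then Hausdorff; where the
  series does not converge in \<open>K(b)\<close>, the value is unspecified.
\<close>

definition hankel ::
    "(nat \<Rightarrow> nat \<Rightarrow> real) \<Rightarrow> (nat \<Rightarrow> 'a::real_normed_field) \<Rightarrow> (nat \<Rightarrow> 'a) \<Rightarrow> (nat \<Rightarrow> 'a)" where
  "hankel b \<theta> x = (THE y. hankel_sums b \<theta> x y)"

definition hankel_well_defined ::
    "(nat \<Rightarrow> nat \<Rightarrow> real) \<Rightarrow> (nat \<Rightarrow> nat \<Rightarrow> real) \<Rightarrow> (nat \<Rightarrow> 'a::real_normed_field) \<Rightarrow> bool" where
  "hankel_well_defined a b \<theta> \<longleftrightarrow>
     (\<forall>n. hankel_column \<theta> n \<in> kothe_space b) \<and>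
     (\<forall>x\<in>kothe_space a. \<exists>y. hankel_sums b \<theta> x y)"

end

theory Submission
  imports Defs
begin

text \<open>
  Since \<open>\<alpha>\<close> is increasing, \<open>2 \<alpha>\<^sub>j\<^sub>+\<^sub>n \<ge> \<alpha>\<^sub>j + \<alpha>\<^sub>n\<close>, so the decay \<open>|\<theta>\<^sub>n| \<le> C exp (- \<alpha>\<^sub>n / m)\<close> splits into
  \<open>|\<theta>\<^sub>j\<^sub>+\<^sub>n| \<le> C exp (- \<alpha>\<^sub>j / (2 m)) exp (- \<alpha>\<^sub>n / (2 m))\<close>.  Hence the \<open>j\<close>-th entry of \<open>H\<^sub>\<theta> x\<close>
  converges absolutely and is at most \<open>C \<parallel>x\<parallel>\<^sub>2\<^sub>m exp (- \<alpha>\<^sub>j / (2 m))\<close>, where the last factor is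
  an element of \<open>K(b)\<close>.  One and the same seminorm \<open>\<parallel>x\<parallel>\<^sub>2\<^sub>m\<close> thus controls all seminorms of
  \<open>H\<^sub>\<theta> x\<close>: the operator maps a neighbourhood of zero to a bounded set.
\<close>

section \<open>Koethe spaces\<close>

lemma kothe_matrix_nonneg: "kothe_matrix b \<Longrightarrow> 0 \<le> b n k"
  by (simp add: kothe_matrix_def)

lemma kothe_matrix_mono: "kothe_matrix b \<Longrightarrow> k \<le> l \<Longrightarrow> b n k \<le> b n l"
  using lift_Suc_mono_le[of "b n" k l] by (simp add: kothe_matrix_def)

lemma kothe_space_summable: "x \<in> kothe_space b \<Longrightarrow> summable (\<lambda>n. norm (x n) * b n k)"
  by (simp add: kothe_space_def)

lemma kothe_space_zero [simp]: "(\<lambda>n. 0) \<in> kothe_space b"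
  by (simp add: kothe_space_def)

lemma kothe_seminorm_zero [simp]: "kothe_seminorm b k (\<lambda>n. 0) = 0"
  by (simp add: kothe_seminorm_def)

text \<open>Koethe spaces are solid, by termwise comparison. The majorant \<open>w\<close> is a real
  sequence rather than an element of the space, so it can be a norm sequence, a sum of two of them
  or an exponential weight. Sums, Hankel columns, tails and Hankel images are all placed in their
  spaces this way.\<close>

lemma kothe_space_dominated:
  assumes b: "kothe_matrix b"
    and w: "\<And>k. summable (\<lambda>n. w n * b n k)"
    and le: "\<And>n. norm (x n) \<le> w n"
  shows "x \<in> kothe_space b" "kothe_seminorm b k x \<le> (\<Sum>n. w n * b n k)"
proof -
  have le': "norm (x n) * b n k \<le> w n * b n k" for n k
    using le kothe_matrix_nonneg[OF b] by (rule mult_right_mono)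
  have s: "summable (\<lambda>n. norm (x n) * b n k)" for k
    by (rule summable_comparison_test'[OF w[of k], of 0])
       (simp add: le' kothe_matrix_nonneg[OF b])
  then show "x \<in> kothe_space b"
    by (simp add: kothe_space_def)
  show "kothe_seminorm b k x \<le> (\<Sum>n. w n * b n k)"
    unfolding kothe_seminorm_def by (rule suminf_le[OF le' s w])
qed

lemma
  assumes b: "kothe_matrix b" and x: "x \<in> kothe_space b" and y: "y \<in> kothe_space b"
  shows kothe_space_add: "(\<lambda>n. x n + y n) \<in> kothe_space b"
    and kothe_space_diff: "(\<lambda>n. x n - y n) \<in> kothe_space b"
    and kothe_seminorm_add:
      "kothe_seminorm b k (\<lambda>n. x n + y n) \<le> kothe_seminorm b k x + kothe_seminorm b k y"
proof -
  have s: "summable (\<lambda>n. (norm (x n) + norm (y n)) * b n k)" for k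
    using summable_add[OF kothe_space_summable[OF x] kothe_space_summable[OF y]]
    by (simp add: distrib_right)
  show "(\<lambda>n. x n + y n) \<in> kothe_space b"
    by (rule kothe_space_dominated(1)[OF b s norm_triangle_ineq])
  show "(\<lambda>n. x n - y n) \<in> kothe_space b"
    by (rule kothe_space_dominated(1)[OF b s norm_triangle_ineq4])
  have "kothe_seminorm b k (\<lambda>n. x n + y n) \<le> (\<Sum>n. (norm (x n) + norm (y n)) * b n k)"
    by (rule kothe_space_dominated(2)[OF b s norm_triangle_ineq])
  then show "kothe_seminorm b k (\<lambda>n. x n + y n) \<le> kothe_seminorm b k x + kothe_seminorm b k y"
    unfolding kothe_seminorm_def
    using suminf_add[OF kothe_space_summable[OF x] kothe_space_summable[OF y], of k k]
    by (simp add: distrib_right)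
qed

lemma
  assumes x: "x \<in> kothe_space b"
  shows kothe_space_scale: "(\<lambda>n. c * x n) \<in> kothe_space b"
    and kothe_seminorm_scale: "kothe_seminorm b k (\<lambda>n. c * x n) = norm c * kothe_seminorm b k x"
proof -
  show "(\<lambda>n. c * x n) \<in> kothe_space b"
    using summable_mult[OF kothe_space_summable[OF x], of "norm c"]
    by (simp add: kothe_space_def norm_mult mult.assoc)
  show "kothe_seminorm b k (\<lambda>n. c * x n) = norm c * kothe_seminorm b k x"
    using suminf_mult[OF kothe_space_summable[OF x], of "norm c" k]
    by (simp add: kothe_seminorm_def norm_mult mult.assoc)
qed

lemma kothe_seminorm_nonneg:
  "kothe_matrix b \<Longrightarrow> x \<in> kothe_space b \<Longrightarrow> 0 \<le> kothe_seminorm b k x"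
  unfolding kothe_seminorm_def
  by (intro suminf_nonneg kothe_space_summable) (simp_all add: kothe_matrix_nonneg)

lemma kothe_seminorm_mono:
  assumes b: "kothe_matrix b" and x: "x \<in> kothe_space b" and "k \<le> l"
  shows "kothe_seminorm b k x \<le> kothe_seminorm b l x"
  unfolding kothe_seminorm_def
  by (intro suminf_le kothe_space_summable[OF x] mult_left_mono kothe_matrix_mono[OF b] assms(3)) simp

lemma kothe_seminorm_coordinate:
  assumes b: "kothe_matrix b" and x: "x \<in> kothe_space b"
  shows "norm (x n) * b n k \<le> kothe_seminorm b k x"
  using sum_le_suminf[OF kothe_space_summable[OF x, of k], of "{n}"]
  by (simp add: kothe_seminorm_def kothe_matrix_nonneg[OF b])

section \<open>The Koethe topology: neighbourhoods, open balls and limits\<close>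

lemma kothe_ball_mono:
  assumes b: "kothe_matrix b" and x: "x \<in> kothe_space b" and "k \<le> l" "r \<le> s"
  shows "kothe_ball b l x r \<subseteq> kothe_ball b k x s"
  using kothe_seminorm_mono[OF b kothe_space_diff[OF b _ x] \<open>k \<le> l\<close>] \<open>r \<le> s\<close>
  by (fastforce simp: kothe_ball_def)

text \<open>By the triangle inequality, the distance left between \<open>y\<close> and the boundary
  of the ball serves as the new radius. This recentring makes generating sets neighbourhoods of each
  of their points.\<close>

lemma kothe_ball_subset_ball:
  assumes b: "kothe_matrix b" and x: "x \<in> kothe_space b" and y: "y \<in> kothe_ball b k x r"
  obtains s where "0 < s" "kothe_ball b k y s \<subseteq> kothe_ball b k x r"
proof
  let ?s = "r - kothe_seminorm b k (\<lambda>n. y n - x n)"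
  show "0 < ?s"
    using y by (simp add: kothe_ball_def)
  have yK: "y \<in> kothe_space b"
    using y by (simp add: kothe_ball_def)
  show "kothe_ball b k y ?s \<subseteq> kothe_ball b k x r"
  proof
    fix z assume z: "z \<in> kothe_ball b k y ?s"
    then have zK: "z \<in> kothe_space b"
      by (simp add: kothe_ball_def)
    have "kothe_seminorm b k (\<lambda>n. z n - x n)
        \<le> kothe_seminorm b k (\<lambda>n. z n - y n) + kothe_seminorm b k (\<lambda>n. y n - x n)"
      using kothe_seminorm_add[OF b kothe_space_diff[OF b zK yK] kothe_space_diff[OF b yK x]]
      by simp
    then show "z \<in> kothe_ball b k x r"
      using z zK by (simp add: kothe_ball_def)
  qed
qed

text \<open>The balls are introduced only as a subbase. Since the seminorms increase with their
  number, two balls around a point contain a common one, with the larger number and the smaller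
  radius; so single balls already form neighbourhood bases. Later arguments about open sets go
  through this criterion.\<close>

lemma openin_kothe_iff:
  fixes U :: "(nat \<Rightarrow> 'a::real_normed_field) set"
  assumes b: "kothe_matrix b"
  shows "openin (kothe_topology b) U \<longleftrightarrow>
    U \<subseteq> kothe_space b \<and> (\<forall>x\<in>U. \<exists>k r. 0 < r \<and> kothe_ball b k x r \<subseteq> U)"
proof safe
  fix x assume "openin (kothe_topology b) U"
  then show "x \<in> kothe_space b" if "x \<in> U"
    using that openin_subset topspace_kothe_topology by blast
next
  fix x assume "openin (kothe_topology b) U" and "x \<in> U"
  then have "generate_topology_on
      {kothe_ball b k x r | k x r. x \<in> (kothe_space b :: (nat \<Rightarrow> 'a) set) \<and> 0 < r} U"
    by (simp add: kothe_topology_def openin_topology_generated_by_iff)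
  then show "\<exists>k r. 0 < r \<and> kothe_ball b k x r \<subseteq> U"
    using \<open>x \<in> U\<close>
  proof (induction arbitrary: x)
    case Empty
    then show ?case by simp
  next
    case (Int U V)
    obtain k r where U: "0 < r" "kothe_ball b k x r \<subseteq> U"
      using Int by blast
    obtain l s where V: "0 < s" "kothe_ball b l x s \<subseteq> V"
      using Int by blast
    \<comment> \<open>Openness of \<open>U\<close> serves to place \<open>x\<close> in the space,
      which the comparison of balls around \<open>x\<close> presupposes.\<close>
    have "openin (kothe_topology b) U"
      using Int(1) by (simp add: kothe_topology_def openin_topology_generated_by_iff)
    then have "x \<in> kothe_space b"
      using Int.prems openin_subset topspace_kothe_topology by blast
    then have "kothe_ball b (max k l) x (min r s) \<subseteq> U \<inter> V"
      using U V kothe_ball_mono[OF b, of x k "max k l" "min r s" r]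
        kothe_ball_mono[OF b, of x l "max k l" "min r s" s] by auto
    then show ?case
      using U V by (metis min_less_iff_conj)
  next
    case (UN \<U>)
    then show ?case by (meson UnionE Union_upper subset_trans)
  next
    case (Basis V)
    then obtain k y r where "V = kothe_ball b k y r" "y \<in> kothe_space b"
      by blast
    then show ?case
      using kothe_ball_subset_ball[OF b, of y x k r] Basis.prems by metis
  qed
next
  assume U: "U \<subseteq> kothe_space b" and *: "\<forall>x\<in>U. \<exists>k r. 0 < r \<and> kothe_ball b k x r \<subseteq> U"
  have ball: "openin (kothe_topology b) (kothe_ball b k x r)" if "x \<in> kothe_space b" "0 < r"
    for k r and x :: "nat \<Rightarrow> 'a"
    unfolding kothe_topology_def by (rule topology_generated_by_Basis) (use that in blast)
  show "openin (kothe_topology b) U"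
  proof (subst openin_subopen, intro ballI)
    fix x assume "x \<in> U"
    then obtain k r where "0 < r" "kothe_ball b k x r \<subseteq> U" and "x \<in> kothe_space b"
      using * U by blast
    moreover from this have "x \<in> kothe_ball b k x r"
      by (simp add: kothe_ball_def)
    ultimately show "\<exists>T. openin (kothe_topology b) T \<and> x \<in> T \<and> T \<subseteq> U"
      using ball by blast
  qed
qed

lemma openin_kothe_ball:
  assumes b: "kothe_matrix b" and x: "x \<in> kothe_space b"
  shows "openin (kothe_topology b) (kothe_ball b k x r)"
  unfolding openin_kothe_iff[OF b]
  using kothe_ball_subset_ball[OF b x, of _ k r] by (metis (no_types, lifting) kothe_ball_def mem_Collect_eq subsetI)

text \<open>Every open set around \<open>y\<close> contains a ball centred at \<open>y\<close>, and
  these balls are open, so it suffices to test the limit on them.\<close>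

lemma limitin_kothe_iff:
  assumes b: "kothe_matrix b" and f: "\<And>i. f i \<in> kothe_space b"
  shows "limitin (kothe_topology b) f y F \<longleftrightarrow>
    y \<in> kothe_space b \<and> (\<forall>k. ((\<lambda>i. kothe_seminorm b k (\<lambda>n. f i n - y n)) \<longlongrightarrow> 0) F)"
proof (intro iffI conjI allI; (elim conjE)?)
  assume "limitin (kothe_topology b) f y F"
  then show "y \<in> kothe_space b"
    using limitin_topspace topspace_kothe_topology by metis
next
  assume lim: "limitin (kothe_topology b) f y F"
  then have y: "y \<in> kothe_space b"
    using limitin_topspace topspace_kothe_topology by metis
  fix k
  show "((\<lambda>i. kothe_seminorm b k (\<lambda>n. f i n - y n)) \<longlongrightarrow> 0) F"
  proof (rule tendstoI)
    fix e :: real assume "0 < e"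
    then have "y \<in> kothe_ball b k y e"
      using y by (simp add: kothe_ball_def)
    then have "\<forall>\<^sub>F i in F. f i \<in> kothe_ball b k y e"
      using lim openin_kothe_ball[OF b y, of k e] by (simp add: limitin_def)
    then show "\<forall>\<^sub>F i in F. dist (kothe_seminorm b k (\<lambda>n. f i n - y n)) 0 < e"
      by eventually_elim (simp add: kothe_ball_def kothe_seminorm_nonneg[OF b kothe_space_diff[OF b f y]])
  qed
next
  assume y: "y \<in> kothe_space b"
    and lim: "\<forall>k. ((\<lambda>i. kothe_seminorm b k (\<lambda>n. f i n - y n)) \<longlongrightarrow> 0) F"
  show "limitin (kothe_topology b) f y F"
    unfolding limitin_def topspace_kothe_topology
  proof (intro conjI y allI impI, elim conjE)
    fix U assume "openin (kothe_topology b) U" "y \<in> U"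
    then obtain k r where "0 < r" "kothe_ball b k y r \<subseteq> U"
      using openin_kothe_iff[OF b] by blast
    moreover have "\<forall>\<^sub>F i in F. kothe_seminorm b k (\<lambda>n. f i n - y n) < r"
      using order_tendstoD(2)[OF lim[rule_format]] \<open>0 < r\<close> .
    ultimately show "\<forall>\<^sub>F i in F. f i \<in> U"
      by (auto elim!: eventually_mono simp: kothe_ball_def f)
  qed
qed

text \<open>For each \<open>n\<close> some \<open>b n k\<close> is positive, and then seminorm
  \<open>k\<close> divided by \<open>b n k\<close> dominates the coordinate \<open>n\<close>. Limits
  are therefore determined by their coordinates, which is what makes the value of a Hankel series
  unique.\<close>

lemma limitin_kothe_coordinate:
  assumes b: "kothe_matrix b" and f: "\<And>i. f i \<in> kothe_space b"
    and lim: "limitin (kothe_topology b) f y F"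
  shows "((\<lambda>i. f i n) \<longlongrightarrow> y n) F"
proof -
  obtain k where k: "0 < b n k"
    using b unfolding kothe_matrix_def by blast
  have y: "y \<in> kothe_space b"
    and "((\<lambda>i. kothe_seminorm b k (\<lambda>n. f i n - y n)) \<longlongrightarrow> 0) F"
    using lim by (auto simp: limitin_kothe_iff[OF b f])
  then have lim0: "((\<lambda>i. kothe_seminorm b k (\<lambda>n. f i n - y n) / b n k) \<longlongrightarrow> 0) F"
    by (intro tendsto_divide_zero)
  have "norm (f i n - y n) \<le> kothe_seminorm b k (\<lambda>n. f i n - y n) / b n k" for i
    using kothe_seminorm_coordinate[OF b kothe_space_diff[OF b f y], of i n k] k
    by (simp add: pos_le_divide_eq)
  then have "\<forall>\<^sub>F i in F. norm (f i n - y n) \<le> kothe_seminorm b k (\<lambda>n. f i n - y n) / b n k"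
    by simp
  then have "((\<lambda>i. f i n - y n) \<longlongrightarrow> 0) F"
    using lim0 by (rule Lim_null_comparison)
  then show ?thesis
    by (simp add: LIM_zero_iff)
qed

section \<open>Continuity, boundedness and precompactness in terms of seminorms\<close>

lemma continuous_map_kothe:
  fixes T :: "(nat \<Rightarrow> 'a::real_normed_field) \<Rightarrow> (nat \<Rightarrow> 'b::real_normed_field)"
  assumes a: "kothe_matrix a" and b: "kothe_matrix b"
    and maps: "\<And>x. x \<in> kothe_space a \<Longrightarrow> T x \<in> kothe_space b"
    and diff: "\<And>x y. x \<in> kothe_space a \<Longrightarrow> y \<in> kothe_space a \<Longrightarrow>
      T (\<lambda>n. x n - y n) = (\<lambda>n. T x n - T y n)"
    and bound: "\<And>k. \<exists>q C. \<forall>x\<in>kothe_space a. kothe_seminorm b k (T x) \<le> C * kothe_seminorm a q x"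
  shows "continuous_map (kothe_topology a) (kothe_topology b) T"
  unfolding continuous_map_def topspace_kothe_topology
proof (intro conjI allI impI)
  show "T \<in> kothe_space a \<rightarrow> kothe_space b"
    using maps by blast
  fix U :: "(nat \<Rightarrow> 'b) set" assume U: "openin (kothe_topology b) U"
  show "openin (kothe_topology a) {x \<in> kothe_space a. T x \<in> U}"
    unfolding openin_kothe_iff[OF a]
  proof (intro conjI ballI)
    fix x assume "x \<in> {x \<in> kothe_space a. T x \<in> U}"
    then have x: "x \<in> kothe_space a" and "T x \<in> U"
      by auto
    then obtain k r where r: "0 < r" "kothe_ball b k (T x) r \<subseteq> U"
      using U openin_kothe_iff[OF b] by blast
    obtain q C where C: "\<And>x. x \<in> kothe_space a \<Longrightarrow> kothe_seminorm b k (T x) \<le> C * kothe_seminorm a q x"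
      using bound by blast
    \<comment> \<open>The constant \<open>C\<close> comes without a sign. The number
      \<open>\<bar>C\<bar> + 1\<close> is positive and at least \<open>C\<close>, so it can be
      divided by and still bounds the growth of \<open>T\<close>.\<close>
    have "y \<in> kothe_space a \<and> T y \<in> U" if "y \<in> kothe_ball a q x (r / (\<bar>C\<bar> + 1))" for y
    proof -
      have y: "y \<in> kothe_space a" and less: "kothe_seminorm a q (\<lambda>n. y n - x n) < r / (\<bar>C\<bar> + 1)"
        using that by (auto simp: kothe_ball_def)
      have "kothe_seminorm b k (\<lambda>n. T y n - T x n) \<le> C * kothe_seminorm a q (\<lambda>n. y n - x n)"
        using C[OF kothe_space_diff[OF a y x]] diff[OF y x] by simp
      also have "\<dots> \<le> (\<bar>C\<bar> + 1) * kothe_seminorm a q (\<lambda>n. y n - x n)"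
        by (intro mult_right_mono kothe_seminorm_nonneg[OF a] kothe_space_diff[OF a y x]) simp
      also have "\<dots> < r"
        using less by (simp add: field_simps pos_less_divide_eq add_pos_nonneg)
      finally show ?thesis
        using r(2) y maps by (auto simp: kothe_ball_def)
    qed
    moreover have "0 < r / (\<bar>C\<bar> + 1)"
      using r(1) by (simp add: add_nonneg_pos)
    ultimately show "\<exists>k r. 0 < r \<and> kothe_ball a k x r \<subseteq> {x \<in> kothe_space a. T x \<in> U}"
      by blast
  qed blast
qed

lemma seq_bounded_kothe:
  fixes B :: "(nat \<Rightarrow> 'a::real_normed_field) set"
  assumes b: "kothe_matrix b" and B: "B \<subseteq> kothe_space b"
    and bound: "\<And>k. \<exists>M. \<forall>y\<in>B. kothe_seminorm b k y \<le> M"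
  shows "seq_bounded (kothe_topology b) B"
  unfolding seq_bounded_def topspace_kothe_topology
proof (intro conjI B allI impI, elim conjE)
  fix U :: "(nat \<Rightarrow> 'a) set" assume "openin (kothe_topology b) U" "(\<lambda>n. 0) \<in> U"
  then obtain k r where r: "0 < r" "kothe_ball b k (\<lambda>n. 0) r \<subseteq> U"
    using openin_kothe_iff[OF b] by blast
  obtain M where M: "\<And>y. y \<in> B \<Longrightarrow> kothe_seminorm b k y \<le> M"
    using bound by blast
  \<comment> \<open>With this choice \<open>t * r\<close> equals \<open>\<bar>M\<bar> + 1\<close>,
    which exceeds \<open>M\<close>, and \<open>t\<close> is positive whatever the sign of
    \<open>M\<close>. Scaling \<open>B\<close> by \<open>1 / t\<close> thus moves it into the ball
    of radius \<open>r\<close>.\<close>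
  define t where "t = (\<bar>M\<bar> + 1) / r"
  have t: "0 < t" "M < t * r"
    using r(1) by (auto simp: t_def)
  have "y \<in> (\<lambda>u n. of_real t * u n) ` U" if "y \<in> B" for y
  proof
    show "y = (\<lambda>n. of_real t * (of_real (1 / t) * y n))"
      using t(1) by simp
    have y: "y \<in> kothe_space b"
      using that B by blast
    have "kothe_seminorm b k y < t * r"
      using M[OF that] t(2) by linarith
    then have "1 / t * kothe_seminorm b k y < r"
      using t(1) by (simp add: pos_divide_less_eq mult.commute)
    moreover have "kothe_seminorm b k (\<lambda>n. of_real (1 / t) * y n) = 1 / t * kothe_seminorm b k y"
      unfolding kothe_seminorm_scale[OF y] norm_of_real using t(1) by simp
    ultimately have "(\<lambda>n. of_real (1 / t) * y n) \<in> kothe_ball b k (\<lambda>n. 0) r"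
      unfolding kothe_ball_def diff_zero by (simp only: mem_Collect_eq kothe_space_scale[OF y])
    then show "(\<lambda>n. of_real (1 / t) * y n) \<in> U"
      using r(2) by (rule rev_subsetD)
  qed
  then show "\<exists>t>0. B \<subseteq> (\<lambda>u n. of_real t * u n) ` U"
    using t(1) by (intro exI[of _ t] conjI subsetI)
qed

text \<open>The ball around \<open>f + u\<close> is the translate by \<open>f\<close> of the ball
  around \<open>u\<close> with the same seminorm and radius.\<close>

lemma openin_kothe_translate:
  assumes b: "kothe_matrix b" and U: "openin (kothe_topology b) U" and f: "f \<in> kothe_space b"
  shows "openin (kothe_topology b) ((\<lambda>u n. f n + u n) ` U)"
  unfolding openin_kothe_iff[OF b]
proof (intro conjI ballI)
  have UK: "U \<subseteq> kothe_space b"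
    using U openin_kothe_iff[OF b] by blast
  then show "(\<lambda>u n. f n + u n) ` U \<subseteq> kothe_space b"
    using kothe_space_add[OF b f subsetD[OF UK]] by (intro image_subsetI)
  fix x assume "x \<in> (\<lambda>u n. f n + u n) ` U"
  then obtain u where u: "u \<in> U" "x = (\<lambda>n. f n + u n)"
    by blast
  then obtain k r where r: "0 < r" "kothe_ball b k u r \<subseteq> U"
    using U openin_kothe_iff[OF b] by blast
  have "y \<in> (\<lambda>u n. f n + u n) ` U" if "y \<in> kothe_ball b k x r" for y
  proof
    show "y = (\<lambda>n. f n + (y n - f n))"
      by simp
    show "(\<lambda>n. y n - f n) \<in> U"
    proof (rule subsetD[OF r(2)])
      have "y \<in> kothe_space b"
        using that by (simp add: kothe_ball_def)
      from kothe_space_diff[OF b this f] show "(\<lambda>n. y n - f n) \<in> kothe_ball b k u r"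
        using that by (simp add: kothe_ball_def u(2) diff_diff_eq)
    qed
  qed
  then show "\<exists>k r. 0 < r \<and> kothe_ball b k x r \<subseteq> (\<lambda>u n. f n + u n) ` U"
    using r(1) by (intro exI[of _ k] exI[of _ r] conjI subsetI)
qed

text \<open>The translates \<open>f + U\<close>, with \<open>f\<close> running through the closure
  of \<open>S\<close>, form an open cover of that closure. The centres of a finite subcover witness
  total boundedness; they lie in the space but need not lie in \<open>S\<close>.\<close>

lemma precompact_kothe_if_compact_closure:
  fixes S :: "(nat \<Rightarrow> 'a::real_normed_field) set"
  assumes b: "kothe_matrix b" and S: "S \<subseteq> kothe_space b"
    and compact: "compactin (kothe_topology b) (kothe_topology b closure_of S)"
  shows "precompact (kothe_topology b) S"
  unfolding precompact_def topspace_kothe_topology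
proof (intro conjI S allI impI, elim conjE)
  fix U :: "(nat \<Rightarrow> 'a) set" assume U: "openin (kothe_topology b) U" "(\<lambda>n. 0) \<in> U"
  let ?cl = "kothe_topology b closure_of S"
  have cl: "?cl \<subseteq> kothe_space b" "S \<subseteq> ?cl"
    using S closure_of_subset_topspace[of "kothe_topology b" S] closure_of_subset[of S "kothe_topology b"]
    by (auto simp: topspace_kothe_topology)
  define V where "V f = (\<lambda>u n. f n + u n) ` U" for f
  have "f \<in> V f" for f
    \<comment> \<open>The representation is \<open>f = f + 0\<close>, with zero in
      \<open>U\<close>.\<close>
    using U(2) unfolding V_def by (rule rev_image_eqI) simp
  then have "?cl \<subseteq> \<Union>(V ` ?cl)"
    by blast
  moreover have "\<forall>W\<in>V ` ?cl. openin (kothe_topology b) W"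
    using openin_kothe_translate[OF b U(1) subsetD[OF cl(1)]] by (simp add: V_def)
  ultimately have "\<exists>\<F>. finite \<F> \<and> \<F> \<subseteq> V ` ?cl \<and> ?cl \<subseteq> \<Union>\<F>"
    using compact by (simp add: compactin_def)
  then obtain \<F> where \<F>: "finite \<F>" "\<F> \<subseteq> V ` ?cl" "?cl \<subseteq> \<Union>\<F>"
    by (elim exE conjE) (rule that)
  from finite_subset_image[OF \<F>(1,2)]
  obtain F where F: "F \<subseteq> ?cl" "finite F" "\<F> = V ` F"
    by (elim exE conjE) (rule that)
  have "F \<subseteq> kothe_space b" "S \<subseteq> \<Union>(V ` F)"
    using subset_trans[OF F(1) cl(1)] subset_trans[OF cl(2) \<F>(3)] F(3) by simp_all
  then show "\<exists>F. finite F \<and> F \<subseteq> kothe_space b \<and> S \<subseteq> (\<Union>f\<in>F. (\<lambda>u n. f n + u n) ` U)"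
    using F(2) unfolding V_def by (intro exI[of _ F] conjI)
qed

section \<open>Hankel operators\<close>

lemma kothe_matrix_power_series:
  assumes "\<And>n. 0 \<le> \<alpha> n"
  shows "kothe_matrix (power_series_matrix \<alpha>)"
proof -
  \<comment> \<open>These are the negated exponents for the numbers \<open>Suc k\<close> and
    \<open>k\<close>. Non-negativity of \<alpha> turns the decrease of the fractions into the
    increase of the matrix in \<open>k\<close>.\<close>
  have "1 / (2 + real k) * \<alpha> n \<le> 1 / (1 + real k) * \<alpha> n" for n k
    using assms by (intro mult_right_mono divide_left_mono) auto
  then show ?thesis
    by (simp add: kothe_matrix_def power_series_matrix_def)
qed

lemma power_series_dual_hankel_bound:
  assumes "\<theta> \<in> power_series_dual \<alpha>" and "incseq \<alpha>"
  obtains q C where "0 \<le> C"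
    "\<And>n j. norm (\<theta> (j + n)) \<le> C * power_series_matrix \<alpha> n q * power_series_matrix \<alpha> j q"
proof -
  obtain p C where C: "\<And>n. norm (\<theta> n) * exp (1 / real (Suc p) * \<alpha> n) \<le> C"
    using assms(1) by (auto simp: power_series_dual_def bdd_above_def)
  show thesis
  proof
    show "0 \<le> C"
      using order_trans[OF _ C[of 0]] by simp
    fix n j
    \<comment> \<open>Because numbering starts at 0, the number \<open>p\<close> stands for the
      factor \<open>1 / (p + 1)\<close>, and its half \<open>1 / (2 * p + 2)\<close> belongs to the
      number \<open>2 * p + 1\<close>.\<close>
    let ?q = "Suc (2 * p)"
    have "\<alpha> n \<le> \<alpha> (j + n)" "\<alpha> j \<le> \<alpha> (j + n)"
      using \<open>incseq \<alpha>\<close> by (auto intro: incseqD)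
    moreover define c where "c = 1 / real (Suc p)"
    ultimately have "c * (\<alpha> n + \<alpha> j) \<le> c * (2 * \<alpha> (j + n))"
      by (intro mult_left_mono) auto
    moreover have half: "1 / real (Suc ?q) = c / 2"
      by (simp add: c_def field_simps)
    ultimately have "- (1 / real (Suc p) * \<alpha> (j + n))
        \<le> - (1 / real (Suc ?q)) * \<alpha> n + - (1 / real (Suc ?q)) * \<alpha> j"
      unfolding half c_def[symmetric] by (simp add: algebra_simps)
    then have *: "exp (- (1 / real (Suc p) * \<alpha> (j + n)))
        \<le> power_series_matrix \<alpha> n ?q * power_series_matrix \<alpha> j ?q"
      unfolding power_series_matrix_def exp_add[symmetric] exp_le_cancel_iff .
    have "norm (\<theta> (j + n)) \<le> C * exp (- (1 / real (Suc p) * \<alpha> (j + n)))"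
      using C[of "j + n"] by (simp add: exp_minus field_simps)
    also have "\<dots> \<le> C * (power_series_matrix \<alpha> n ?q * power_series_matrix \<alpha> j ?q)"
      using * \<open>0 \<le> C\<close> by (rule mult_left_mono)
    finally show "norm (\<theta> (j + n)) \<le> C * power_series_matrix \<alpha> n ?q * power_series_matrix \<alpha> j ?q"
      by (simp add: mult.assoc)
  qed
qed

text \<open>All that is kept of \<alpha> is a bound on \<theta> by a product. The factor
  \<open>a n q\<close> is paired with \<open>x\<close> to form its seminorm \<open>q\<close>, while
  \<open>w\<close> acts as a majorant in the target space. Neither \<open>q\<close> nor
  \<open>C\<close> depends on a target seminorm, and compactness rests on this. The sort
  \<open>banach\<close> makes the scalars complete.\<close>

locale dominated_hankel =
  fixes a b :: "nat \<Rightarrow> nat \<Rightarrow> real" and \<theta> :: "nat \<Rightarrow> 'a::{real_normed_field, banach}"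
    and w :: "nat \<Rightarrow> real" and C :: real and q :: nat
  assumes a: "kothe_matrix a" and b: "kothe_matrix b"
    and w_summable: "\<And>k. summable (\<lambda>j. w j * b j k)"
    and w_nonneg: "\<And>j. 0 \<le> w j" and C_nonneg: "0 \<le> C"
    and bound: "\<And>n j. norm (\<theta> (j + n)) \<le> C * a n q * w j"
begin

lemma column_in_kothe_space: "hankel_column \<theta> n \<in> kothe_space b"
proof (rule kothe_space_dominated(1)[OF b])
  show "summable (\<lambda>j. C * a n q * w j * b j k)" for k
    using summable_mult[OF w_summable, of "C * a n q"] by (simp add: mult.assoc)
  show "norm (hankel_column \<theta> n j) \<le> C * a n q * w j" for j
    by (simp add: hankel_column_def bound)
qed

lemma
  assumes x: "x \<in> kothe_space a"
  shows entry_summable: "summable (\<lambda>n. x n * \<theta> (j + n))"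
    and entry_bound: "norm (\<Sum>n. x n * \<theta> (j + n)) \<le> C * w j * kothe_seminorm a q x"
proof -
  have le: "norm (x n * \<theta> (j + n)) \<le> C * w j * (norm (x n) * a n q)" for n
    using mult_left_mono[OF bound[of j n], of "norm (x n)"] by (simp add: norm_mult mult_ac)
  have s: "summable (\<lambda>n. C * w j * (norm (x n) * a n q))"
    by (rule summable_mult[OF kothe_space_summable[OF x]])
  have sn: "summable (\<lambda>n. norm (x n * \<theta> (j + n)))"
    by (rule summable_comparison_test'[OF s, of 0]) (use le in simp)
  \<comment> \<open>Completeness of the scalars enters: absolute convergence gives
    convergence.\<close>
  then show "summable (\<lambda>n. x n * \<theta> (j + n))"
    by (rule summable_norm_cancel)
  show "norm (\<Sum>n. x n * \<theta> (j + n)) \<le> C * w j * kothe_seminorm a q x"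
    using order_trans[OF summable_norm[OF sn] suminf_le[OF le sn s]]
      suminf_mult[OF kothe_space_summable[OF x], of "C * w j" q]
    by (simp add: kothe_seminorm_def)
qed

text \<open>By the entry bound the sequence of entries is dominated by a scalar multiple of
  \<open>w\<close>, so solidity of the target space applies for every \<open>k\<close> at
  once.\<close>

lemma
  assumes x: "x \<in> kothe_space a"
  shows entries_in_kothe_space: "(\<lambda>j. \<Sum>n. x n * \<theta> (j + n)) \<in> kothe_space b"
    and entries_seminorm_bound: "kothe_seminorm b k (\<lambda>j. \<Sum>n. x n * \<theta> (j + n))
      \<le> C * (\<Sum>j. w j * b j k) * kothe_seminorm a q x"
proof -
  have eq: "C * w j * kothe_seminorm a q x * b j k = C * kothe_seminorm a q x * (w j * b j k)" for j k
    by simp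
  have s: "summable (\<lambda>j. C * w j * kothe_seminorm a q x * b j k)" for k
    unfolding eq by (rule summable_mult[OF w_summable])
  note * = kothe_space_dominated[OF b s entry_bound[OF x]]
  show "(\<lambda>j. \<Sum>n. x n * \<theta> (j + n)) \<in> kothe_space b"
    by (rule *(1))
  show "kothe_seminorm b k (\<lambda>j. \<Sum>n. x n * \<theta> (j + n)) \<le> C * (\<Sum>j. w j * b j k) * kothe_seminorm a q x"
    using *(2)[of k] unfolding eq suminf_mult[OF w_summable] by (simp add: mult_ac)
qed

lemma partial_sum_in_kothe_space: "(\<lambda>j. \<Sum>n<N. x n * hankel_column \<theta> n j) \<in> kothe_space b"
  by (induction N) (auto intro!: kothe_space_add[OF b] kothe_space_scale column_in_kothe_space)

text \<open>The remainder after \<open>N\<close> terms of the Hankel series is the image of the tail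
  of \<open>x\<close> from place \<open>N\<close> on. The seminorm estimate for images bounds it by
  a constant times seminorm \<open>q\<close> of that tail, which tends to 0 as the remainder of a
  convergent series.\<close>

lemma hankel_sums_entries:
  assumes x: "x \<in> kothe_space a"
  shows "hankel_sums b \<theta> x (\<lambda>j. \<Sum>n. x n * \<theta> (j + n))"
  unfolding hankel_sums_def limitin_kothe_iff[OF b partial_sum_in_kothe_space]
proof (intro conjI allI entries_in_kothe_space x)
  fix k
  define tail where "tail N n = (if n < N then 0 else x n)" for N n
  have tail: "tail N \<in> kothe_space a" for N
    by (rule kothe_space_dominated(1)[OF a kothe_space_summable[OF x]]) (simp add: tail_def)
  \<comment> \<open>Both full sums are split at \<open>N\<close>: they agree after it, and the
    initial segment of the tail contributes 0. The same device identifies the remainders of the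
    entries below.\<close>
  have tail_sum: "(\<Sum>n. norm (tail N n) * a n q)
      = kothe_seminorm a q x - (\<Sum>n<N. norm (x n) * a n q)" for N
    using suminf_minus_initial_segment[OF kothe_space_summable[OF tail[of N], of q], of N]
      suminf_minus_initial_segment[OF kothe_space_summable[OF x, of q], of N]
    by (simp add: tail_def kothe_seminorm_def)
  have "(\<lambda>N. kothe_seminorm a q x - (\<Sum>n<N. norm (x n) * a n q)) \<longlonglongrightarrow> kothe_seminorm a q x - kothe_seminorm a q x"
    unfolding kothe_seminorm_def by (intro tendsto_diff tendsto_const summable_LIMSEQ kothe_space_summable[OF x])
  then have "(\<lambda>N. kothe_seminorm a q (tail N)) \<longlonglongrightarrow> 0"
    by (simp add: tail_sum kothe_seminorm_def)
  then have lim: "(\<lambda>N. C * (\<Sum>j. w j * b j k) * kothe_seminorm a q (tail N)) \<longlonglongrightarrow> 0"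
    using tendsto_mult_right_zero by blast
  have "(\<Sum>n. x n * \<theta> (j + n)) - (\<Sum>n<N. x n * \<theta> (j + n)) = (\<Sum>n. tail N n * \<theta> (j + n))" for N j
    using suminf_minus_initial_segment[OF entry_summable[OF tail[of N], of j], of N]
      suminf_minus_initial_segment[OF entry_summable[OF x, of j], of N]
    by (simp add: tail_def)
  \<comment> \<open>The sign is written as the scalar \<open>- 1\<close>, so that homogeneity of the
    seminorm removes it.\<close>
  then have "(\<Sum>n<N. x n * hankel_column \<theta> n j) - (\<Sum>n. x n * \<theta> (j + n))
      = - 1 * (\<Sum>n. tail N n * \<theta> (j + n))" for N j
    unfolding hankel_column_def by (metis minus_diff_eq mult_minus1)
  then have "kothe_seminorm b k (\<lambda>j. (\<Sum>n<N. x n * hankel_column \<theta> n j) - (\<Sum>n. x n * \<theta> (j + n)))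
      \<le> C * (\<Sum>j. w j * b j k) * kothe_seminorm a q (tail N)" for N
    using entries_seminorm_bound[OF tail, of k N] kothe_seminorm_scale[OF entries_in_kothe_space[OF tail], of k "- 1" N]
    by simp
  moreover have "0 \<le> kothe_seminorm b k (\<lambda>j. (\<Sum>n<N. x n * hankel_column \<theta> n j) - (\<Sum>n. x n * \<theta> (j + n)))" for N
    by (rule kothe_seminorm_nonneg[OF b kothe_space_diff[OF b partial_sum_in_kothe_space entries_in_kothe_space[OF x]]])
  ultimately show "(\<lambda>N. kothe_seminorm b k (\<lambda>j. (\<Sum>n<N. x n * hankel_column \<theta> n j) - (\<Sum>n. x n * \<theta> (j + n))))
      \<longlonglongrightarrow> 0"
    by (intro tendsto_sandwich[OF always_eventually always_eventually tendsto_const lim] allI)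
qed

text \<open>Any limit of the partial sums is also their limit in each coordinate, where the partial
  sums are those of a convergent scalar series. This forces uniqueness and evaluates the definite
  description.\<close>

lemma hankel_eq_entries:
  assumes x: "x \<in> kothe_space a"
  shows "hankel b \<theta> x = (\<lambda>j. \<Sum>n. x n * \<theta> (j + n))"
  unfolding hankel_def
proof (rule the_equality)
  show "hankel_sums b \<theta> x (\<lambda>j. \<Sum>n. x n * \<theta> (j + n))"
    by (rule hankel_sums_entries[OF x])
  fix y assume "hankel_sums b \<theta> x y"
  then have "(\<lambda>N. \<Sum>n<N. x n * hankel_column \<theta> n j) \<longlonglongrightarrow> y j" for j
    unfolding hankel_sums_def
    by (rule limitin_kothe_coordinate[OF b partial_sum_in_kothe_space])
  then show "y = (\<lambda>j. \<Sum>n. x n * \<theta> (j + n))"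
    by (auto simp: hankel_column_def sums_def intro!: sums_unique)
qed

section \<open>Linearity, continuity and compactness of the Hankel operator\<close>

lemma hankel_well_defined: "hankel_well_defined a b \<theta>"
  using column_in_kothe_space hankel_sums_entries by (auto simp: hankel_well_defined_def)

lemma hankel_in_kothe_space: "x \<in> kothe_space a \<Longrightarrow> hankel b \<theta> x \<in> kothe_space b"
  by (simp add: hankel_eq_entries entries_in_kothe_space)

lemma hankel_seminorm_bound:
  "x \<in> kothe_space a \<Longrightarrow>
    kothe_seminorm b k (hankel b \<theta> x) \<le> C * (\<Sum>j. w j * b j k) * kothe_seminorm a q x"
  by (simp add: hankel_eq_entries entries_seminorm_bound)

lemma hankel_add:
  assumes "x \<in> kothe_space a" "y \<in> kothe_space a"
  shows "hankel b \<theta> (\<lambda>n. x n + y n) = (\<lambda>n. hankel b \<theta> x n + hankel b \<theta> y n)"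
  using assms
  by (simp add: hankel_eq_entries kothe_space_add[OF a] suminf_add[OF entry_summable entry_summable] distrib_right)

lemma hankel_diff:
  assumes "x \<in> kothe_space a" "y \<in> kothe_space a"
  shows "hankel b \<theta> (\<lambda>n. x n - y n) = (\<lambda>n. hankel b \<theta> x n - hankel b \<theta> y n)"
  using assms
  by (simp add: hankel_eq_entries kothe_space_diff[OF a] suminf_diff[OF entry_summable entry_summable] left_diff_distrib)

lemma hankel_scale:
  assumes "x \<in> kothe_space a"
  shows "hankel b \<theta> (\<lambda>n. c * x n) = (\<lambda>n. c * hankel b \<theta> x n)"
  using assms
  by (simp add: hankel_eq_entries kothe_space_scale suminf_mult[OF entry_summable] mult.assoc)

lemma continuous_map_hankel: "continuous_map (kothe_topology a) (kothe_topology b) (hankel b \<theta>)"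
proof (rule continuous_map_kothe[where T = "hankel b \<theta>", OF a b])
  show "\<exists>q C. \<forall>x\<in>kothe_space a. kothe_seminorm b k (hankel b \<theta> x) \<le> C * kothe_seminorm a q x" for k
    by (intro exI[of _ q] exI[of _ "C * (\<Sum>j. w j * b j k)"] ballI hankel_seminorm_bound)
qed (fact hankel_in_kothe_space hankel_diff)+

text \<open>The neighbourhood of zero is the unit ball of the seminorm \<open>q\<close>. Its image
  is bounded in every seminorm, the Montel property gives it compact closure, and compact closure
  gives precompactness.\<close>

lemma compact_operator_hankel:
  assumes montel: "montel (kothe_topology b :: (nat \<Rightarrow> 'a) topology)"
  shows "compact_operator (kothe_topology a) (kothe_topology b) (hankel b \<theta>)"
proof -
  let ?U = "kothe_ball a q (\<lambda>n. 0) 1 :: (nat \<Rightarrow> 'a) set"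
  have U: "?U \<subseteq> kothe_space a" "openin (kothe_topology a) ?U" "(\<lambda>n. 0) \<in> ?U"
    using openin_kothe_ball[OF a kothe_space_zero] by (simp_all add: kothe_ball_def)
  have "kothe_seminorm b k (hankel b \<theta> x) \<le> C * (\<Sum>j. w j * b j k)" if "x \<in> ?U" for k x
  proof -
    have x: "x \<in> kothe_space a" "kothe_seminorm a q x \<le> 1"
      using that by (auto simp: kothe_ball_def)
    \<comment> \<open>The sign of the constant is what allows the factor
      \<open>kothe_seminorm a q x\<close>, at most 1, to be dropped.\<close>
    have "0 \<le> C * (\<Sum>j. w j * b j k)"
      by (intro mult_nonneg_nonneg C_nonneg suminf_nonneg w_summable w_nonneg kothe_matrix_nonneg[OF b])
    then show ?thesis
      using hankel_seminorm_bound[OF x(1), of k] mult_left_le[OF x(2)] by (meson order_trans)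
  qed
  then have "\<exists>M. \<forall>y\<in>hankel b \<theta> ` ?U. kothe_seminorm b k y \<le> M" for k
    by (intro exI[of _ "C * (\<Sum>j. w j * b j k)"]) simp
  moreover have image: "hankel b \<theta> ` ?U \<subseteq> kothe_space b"
    using hankel_in_kothe_space[OF subsetD[OF U(1)]] by (rule image_subsetI)
  ultimately have "seq_bounded (kothe_topology b) (hankel b \<theta> ` ?U)"
    by (intro seq_bounded_kothe[OF b])
  then have "compactin (kothe_topology b) (kothe_topology b closure_of (hankel b \<theta> ` ?U))"
    using montel by (simp add: montel_def)
  then have "precompact (kothe_topology b) (hankel b \<theta> ` ?U)"
    using image by (intro precompact_kothe_if_compact_closure[OF b])
  then show ?thesis
    unfolding compact_operator_def topspace_kothe_topology
    using U(2,3)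
    by (intro conjI ballI allI exI[of _ ?U] image_subsetI hankel_in_kothe_space hankel_add hankel_scale)
qed

end

theorem proposition3p14:
  fixes \<alpha> :: "nat \<Rightarrow> real"
    and b :: "nat \<Rightarrow> nat \<Rightarrow> real"
    and \<theta> :: "nat \<Rightarrow> 'a::{real_normed_field, banach}"
  assumes "\<And>n. 0 \<le> \<alpha> n" and "incseq \<alpha>" and "filterlim \<alpha> at_top sequentially"
    and "kothe_matrix b"
    and "\<theta> \<in> power_series_dual \<alpha>"
    and "\<And>m. (\<lambda>n. of_real (exp (- (1 / real (Suc m)) * \<alpha> n)) :: 'a) \<in> kothe_space b"
  shows "hankel_well_defined (power_series_matrix \<alpha>) b \<theta>
    \<and> continuous_map (kothe_topology (power_series_matrix \<alpha>)) (kothe_topology b) (hankel b \<theta>)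
    \<and> (montel (kothe_topology b :: (nat \<Rightarrow> 'a) topology) \<longrightarrow>
         compact_operator (kothe_topology (power_series_matrix \<alpha>)) (kothe_topology b) (hankel b \<theta>))"
proof -
  obtain q C where C: "0 \<le> C"
    "\<And>n j. norm (\<theta> (j + n)) \<le> C * power_series_matrix \<alpha> n q * power_series_matrix \<alpha> j q"
    by (rule power_series_dual_hankel_bound[OF assms(5,2)]) (rule that)
  \<comment> \<open>The exponential with number \<open>q\<close> plays two roles: it is a weight of
    the source space and, by the hypothesis taken at \<open>m = q\<close>, the majorant
    \<open>w\<close> in the target space.\<close>
  have "summable (\<lambda>j. power_series_matrix \<alpha> j q * b j k)" for k
    using kothe_space_summable[OF assms(6)[of q], of k] by (simp add: power_series_matrix_def)
  then interpret dominated_hankel "power_series_matrix \<alpha>" b \<theta> "\<lambda>j. power_series_matrix \<alpha> j q" C q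
    using kothe_matrix_power_series[OF assms(1)] assms(4) C
    by unfold_locales (auto simp: power_series_matrix_def)
  show ?thesis
    by (intro conjI impI hankel_well_defined continuous_map_hankel compact_operator_hankel)
qed

end
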